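(* The directed coverage measure $I_{DC}$ satisfies monotonicity.
   Context: For $x,y\in\mathbb{R}^d$, $y$ dominates $x$ if $x_i\le y_i$ for all $i\in[d]$ and $x_j<y_j$ for some $j\in[d]$. A set of alternatives is a finite set $A\subseteq\mathbb{R}^d$ ($d\ge 1$ arbitrary) none of whose elements is dominated by another element of $A$. Let $\|x-y\|_+=\sum_{i=1}^d\max(x_i-y_i,0)$. For a finite set $B\subseteq\mathbb{R}^d$ and nonempty $S\subseteq B$, $I_{DC}(S,B)=\max_{a\in B}\min_{s\in S}\|a-s\|_+$ (lower is better). For a positive integer $k$, $\mathcal{S}(I_{DC},B,k)$ is the set of all $S\subseteq B$ with $|S|=k$ minimizing $I_{DC}(S,B)$ among the size-$k$ subsets of $B$. Monotonicity of a measure $I$: for any set of alternatives $A$, any $k\in\mathbb{N}$ and any $S\in\mathcal{S}(I,A,k)$ with $x\in S$: if $y\in\mathbb{R}^d$ dominates $x$, then there exists $S'\in\mathcal{S}(I,(A\setminus\{x\})\cup\{y\},k)$ with $y\in S'$. *)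

theory Defs
  imports "HOL-Analysis.Finite_Cartesian_Product"
begin

text \<open>
  The space of dimension \<open>d \<ge> 1\<close> is \<open>real ^ 'd\<close> with \<open>d = CARD('d)\<close>; the free type variable
  makes the dimension arbitrary.
\<close>

definition dominates :: "real ^ 'd::finite \<Rightarrow> real ^ 'd \<Rightarrow> bool" where
  "dominates y x \<longleftrightarrow> (\<forall>i. x $ i \<le> y $ i) \<and> (\<exists>j. x $ j < y $ j)"

definition alternatives :: "(real ^ 'd::finite) set \<Rightarrow> bool" where
  "alternatives A \<longleftrightarrow> finite A \<and> (\<forall>x\<in>A. \<forall>y\<in>A. \<not> dominates y x)"

definition norm_plus :: "real ^ 'd::finite \<Rightarrow> real" where
  "norm_plus v = (\<Sum>i\<in>UNIV. max (v $ i) 0)"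

text \<open>The value is meaningful only for finite \<open>B\<close> and nonempty \<open>S \<subseteq> B\<close>.\<close>

definition I_DC :: "(real ^ 'd::finite) set \<Rightarrow> (real ^ 'd) set \<Rightarrow> real" where
  "I_DC S B = Max ((\<lambda>a. Min ((\<lambda>s. norm_plus (a - s)) ` S)) ` B)"

definition optimal_subsets ::
  "((real ^ 'd::finite) set \<Rightarrow> (real ^ 'd) set \<Rightarrow> real) \<Rightarrow> (real ^ 'd) set \<Rightarrow> nat \<Rightarrow> (real ^ 'd) set set"
  where
  "optimal_subsets I B k =
    {S. S \<subseteq> B \<and> card S = k \<and> (\<forall>T. T \<subseteq> B \<and> card T = k \<longrightarrow> I S B \<le> I T B)}"

text \<open>
  The modified set \<open>(A - {x}) \<union> {y}\<close> is not required to be a set of alternatives again: \<open>y\<close> may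
  dominate further elements of \<open>A\<close>.
\<close>

definition monotonicity :: "((real ^ 'd::finite) set \<Rightarrow> (real ^ 'd) set \<Rightarrow> real) \<Rightarrow> bool" where
  "monotonicity I \<longleftrightarrow>
    (\<forall>A k S x y. alternatives A \<longrightarrow> k \<ge> 1 \<longrightarrow> S \<in> optimal_subsets I A k \<longrightarrow> x \<in> S \<longrightarrow> dominates y x \<longrightarrow>
      (\<exists>S'. S' \<in> optimal_subsets I ((A - {x}) \<union> {y}) k \<and> y \<in> S'))"

end

(* Let A' = (A - {x}) Un {y} and S' = (S - {x}) Un {y}. Raising x to y shortens every directed
   distance to it and lengthens every directed distance from it. Hence I_DC S' A' <= I_DC S A, while
   I_DC T A <= I_DC T A' for every T contained in A - {x}. An optimal T for A' therefore either
   contains y, or I_DC S' A' <= I_DC S A <= I_DC T A <= I_DC T A', so that S' is optimal too. *)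

theory Submission
  imports Defs
begin

lemma norm_plus_nonneg: "0 \<le> norm_plus v"
  unfolding norm_plus_def by (simp add: sum_nonneg)

lemma norm_plus_zero [simp]: "norm_plus 0 = 0"
  unfolding norm_plus_def by simp

lemma norm_plus_mono:
  assumes "\<And>i. v $ i \<le> w $ i"
  shows "norm_plus v \<le> norm_plus w"
  unfolding norm_plus_def by (intro sum_mono max.mono assms order_refl)

text \<open>Trades \<open>Max\<close> and \<open>Min\<close> for quantifiers. Finiteness and
  nonemptiness make both extrema attained values.\<close>

lemma I_DC_le_iff:
  assumes "finite S" "S \<noteq> {}" "finite B" "B \<noteq> {}"
  shows "I_DC S B \<le> c \<longleftrightarrow> (\<forall>a\<in>B. \<exists>s\<in>S. norm_plus (a - s) \<le> c)"
  unfolding I_DC_def using assms by (simp add: Min_le_iff)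

text \<open>Match each \<open>a\<close> with a point \<open>c\<close>. Some \<open>t\<close> lies
  within \<open>I_DC T C\<close> of \<open>c\<close>, and the \<open>s\<close> found for this
  \<open>t\<close> is at least as close to \<open>a\<close>. So \<open>c\<close> is fixed before
  \<open>t\<close>, while \<open>s\<close> may depend on \<open>t\<close>.\<close>

lemma I_DC_le_I_DC:
  assumes "finite S" "S \<noteq> {}" "finite B" "B \<noteq> {}" "finite T" "T \<noteq> {}" "finite C" "C \<noteq> {}"
    and "\<And>a. a \<in> B \<Longrightarrow> \<exists>c\<in>C. \<forall>t\<in>T. \<exists>s\<in>S. norm_plus (a - s) \<le> norm_plus (c - t)"
  shows "I_DC S B \<le> I_DC T C"
proof -
  \<comment> \<open>The bound is taken to be the value \<open>I_DC T C\<close> itself.\<close>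
  have "\<forall>c\<in>C. \<exists>t\<in>T. norm_plus (c - t) \<le> I_DC T C"
    using I_DC_le_iff[OF assms(5-8), of "I_DC T C"] by simp
  with assms(9) have "\<forall>a\<in>B. \<exists>s\<in>S. norm_plus (a - s) \<le> I_DC T C"
    by (meson order_trans)
  then show ?thesis
    using I_DC_le_iff[OF assms(1-4), of "I_DC T C"] by simp
qed

lemma I_DC_raise_representative:
  assumes "finite A" "S \<subseteq> A" "x \<in> S" and le: "\<And>i. x $ i \<le> y $ i"
  shows "I_DC ((S - {x}) \<union> {y}) ((A - {x}) \<union> {y}) \<le> I_DC S A"
proof (rule I_DC_le_I_DC)
  fix a assume a: "a \<in> (A - {x}) \<union> {y}"
  show "\<exists>c\<in>A. \<forall>t\<in>S. \<exists>s\<in>(S - {x}) \<union> {y}. norm_plus (a - s) \<le> norm_plus (c - t)"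
  proof (cases "a = y")
    case True
    \<comment> \<open>\<open>y\<close> represents itself at distance 0, so any member of
      \<open>A\<close> would do as \<open>c\<close>.\<close>
    with assms show ?thesis by (intro bexI[of _ x]) (auto simp: norm_plus_nonneg)
  next
    case False
    have "\<exists>s\<in>(S - {x}) \<union> {y}. norm_plus (a - s) \<le> norm_plus (a - t)" if "t \<in> S" for t
    proof (cases "t = x")
      case True
      with le have "norm_plus (a - y) \<le> norm_plus (a - t)" by (intro norm_plus_mono) simp
      then show ?thesis by blast
    next
      case False
      with that show ?thesis by blast
    qed
    with False a show ?thesis by blast
  qed
qed (use assms in \<open>auto intro: finite_subset\<close>)

text \<open>Match \<open>x\<close> with \<open>y\<close> and every other point with itself, keeping
  the representative: x - t \<le> y - t in each coordinate.\<close>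

lemma I_DC_raise_target:
  assumes "finite A" "finite T" "T \<noteq> {}" "x \<in> A" and le: "\<And>i. x $ i \<le> y $ i"
  shows "I_DC T A \<le> I_DC T ((A - {x}) \<union> {y})"
proof (rule I_DC_le_I_DC)
  fix a assume a: "a \<in> A"
  have "norm_plus (x - t) \<le> norm_plus (y - t)" for t
    using le by (intro norm_plus_mono) simp
  with a show "\<exists>c\<in>(A - {x}) \<union> {y}. \<forall>t\<in>T. \<exists>s\<in>T. norm_plus (a - s) \<le> norm_plus (c - t)"
    by (cases "a = x") blast+
qed (use assms in auto)

text \<open>\<open>S\<close> witnesses that the finite family of candidates of its size is nonempty,
  so a minimizer exists.\<close>

lemma optimal_subset_exists:
  assumes "finite B" "S \<subseteq> B"
  obtains T where "T \<in> optimal_subsets I B (card S)"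
proof -
  let ?F = "{T. T \<subseteq> B \<and> card T = card S}"
  have "finite ?F" "?F \<noteq> {}" using assms by auto
  then obtain T where "is_arg_min (\<lambda>T. I T B) (\<lambda>T. T \<in> ?F) T"
    using ex_is_arg_min_if_finite[of ?F "\<lambda>T. I T B"] by blast
  then show thesis
    using that by (auto simp: optimal_subsets_def is_arg_min_linorder)
qed

theorem proposition13:
  "monotonicity (I_DC :: (real ^ 'd::finite) set \<Rightarrow> (real ^ 'd) set \<Rightarrow> real)"
  unfolding monotonicity_def
proof (intro allI impI)
  fix A S :: "(real ^ 'd) set" and k :: nat and x y
  assume alt: "alternatives A" and k: "k \<ge> 1" and S: "S \<in> optimal_subsets I_DC A k"
    and x: "x \<in> S" and dom: "dominates y x"
  define A' where "A' = (A - {x}) \<union> {y}"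
  define S' where "S' = (S - {x}) \<union> {y}"
  have SA: "S \<subseteq> A" and cS: "card S = k"
    and opt: "\<And>T. T \<subseteq> A \<Longrightarrow> card T = k \<Longrightarrow> I_DC S A \<le> I_DC T A"
    using S by (auto simp: optimal_subsets_def)
  \<comment> \<open>If \<open>y\<close> were in \<open>A\<close>, it would dominate the alternative
    \<open>x\<close>.\<close>
  have finA: "finite A" and "y \<notin> A"
    using alt dom x SA by (auto simp: alternatives_def)
  have le: "\<And>i. x $ i \<le> y $ i"
    using dom by (simp add: dominates_def)
  have S'A': "S' \<subseteq> A'" using SA by (auto simp: S'_def A'_def)
  have "finite S" using SA finA by (rule finite_subset)
  \<comment> \<open>The swap keeps the size because \<open>y\<close> is new to
    \<open>S\<close>.\<close>
  then have cS': "card S' = k"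
    using \<open>y \<notin> A\<close> SA x cS k by (auto simp: S'_def card_insert_if)
  have "finite A'" using finA by (simp add: A'_def)
  then obtain T where T: "T \<in> optimal_subsets I_DC A' k"
    using optimal_subset_exists[OF _ S'A'] unfolding cS' by blast
  show "\<exists>S'. S' \<in> optimal_subsets I_DC ((A - {x}) \<union> {y}) k \<and> y \<in> S'"
  proof (cases "y \<in> T")
    case True
    with T show ?thesis by (auto simp: A'_def)
  next
    case False
    \<comment> \<open>Without \<open>y\<close>, the set \<open>T\<close> lies in
      \<open>A - {x}\<close> and so competes with \<open>S\<close> in the original problem.\<close>
    with T have TA: "T \<subseteq> A" and cT: "card T = k"
      by (auto simp: optimal_subsets_def A'_def)
    have "I_DC S' A' \<le> I_DC S A"
      unfolding S'_def A'_def by (rule I_DC_raise_representative[OF finA SA x le])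
    also have "\<dots> \<le> I_DC T A" using TA cT by (rule opt)
    also have "\<dots> \<le> I_DC T A'"
      \<comment> \<open>Here \<open>k \<ge> 1\<close> makes \<open>T\<close> nonempty.\<close>
      unfolding A'_def using k cT x SA finA TA le
      by (intro I_DC_raise_target) (auto intro: finite_subset)
    finally have "I_DC S' A' \<le> I_DC T A'" .
    with T have "S' \<in> optimal_subsets I_DC A' k"
      using S'A' cS' unfolding optimal_subsets_def by (auto intro: order_trans)
    then show ?thesis by (auto simp: A'_def S'_def)
  qed
qed

end
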